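(* Let $(E,d)$ and $(E',d')$ be metric spaces, let $Z$ be an $E$-valued random variable, and let $\Lambda:E\to\mathbb R_+$ be measurable. Suppose there exist two strictly decreasing functions $\alpha,\beta:\mathbb R_+\to\mathbb R_+$ such that, for every $1$-Lipschitz map $f:E\to\mathbb R$ and any independent copy $Z'$ of $Z$, $$\forall t\ge 0:\qquad \mathbb P\left(|f(Z)-f(Z')|>t\right)\le \alpha(t),\qquad \mathbb P\left(\Lambda(Z)>t\right)\le\beta(t).$$ Let $\Phi:E\to E'$ satisfy $$\forall z,z'\in E:\qquad d'(\Phi(z),\Phi(z'))\le \max(\Lambda(z),\Lambda(z'))\,d(z,z').$$ Then, for every $1$-Lipschitz map $g:E'\to\mathbb R$ and any independent copy $Z'$ of $Z$, $$\forall t\ge 0:\qquad \mathbb P\left(|g(\Phi(Z))-g(\Phi(Z'))|>t\right)\le 3\,(\alpha^{-1}\cdot\beta^{-1})^{-1}(t).$$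
   Context: $\mathbb R_+=[0,\infty)$. For a strictly decreasing function $\alpha:\mathbb R_+\to\mathbb R_+$, $\alpha^{-1}:\alpha(\mathbb R_+)\to\mathbb R_+$ is its inverse. The product $\alpha^{-1}\cdot\beta^{-1}$ is the pointwise product $u\mapsto\alpha^{-1}(u)\beta^{-1}(u)$, defined on $\alpha(\mathbb R_+)\cap\beta(\mathbb R_+)$; it is injective and $(\alpha^{-1}\cdot\beta^{-1})^{-1}$ is its inverse. The final inequality is understood at every $t\ge0$ at which the right-hand side is defined, i.e. every $t$ of the form $t=\alpha^{-1}(u)\beta^{-1}(u)$ (in which case the right-hand side equals $3u$). *)

theory Defs
  imports "HOL-Probability.Probability"
begin

text \<open>An independent copy of a random variable on \<open>M\<close> need not exist on \<open>M\<close> itself, so it is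
  looked for on an extension of \<open>M\<close>: a probability space \<open>N\<close> with a measure-preserving map
  \<open>\<pi>\<close> to \<open>M\<close>, a random variable \<open>Z\<close> on \<open>M\<close> being read on \<open>N\<close> as \<open>Z \<circ> \<pi>\<close>.
  The choice \<open>N = M\<close>, \<open>\<pi> = id\<close> is included.\<close>

definition prob_extension :: "'w measure \<Rightarrow> 'v measure \<Rightarrow> ('v \<Rightarrow> 'w) \<Rightarrow> bool" where
  "prob_extension M N \<pi> \<longleftrightarrow> prob_space N \<and> \<pi> \<in> measurable N M \<and> distr N M \<pi> = M"

text \<open>Measurability of both variables is part of \<^const>\<open>prob_space.indep_var\<close>.\<close>

definition independent_copy ::
    "'v measure \<Rightarrow> ('v \<Rightarrow> 'e::metric_space) \<Rightarrow> ('v \<Rightarrow> 'e) \<Rightarrow> bool" where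
  "independent_copy N Y Y' \<longleftrightarrow>
     prob_space.indep_var N borel Y borel Y' \<and> distr N borel Y' = distr N borel Y"

text \<open>For \<open>\<alpha>\<close>, \<open>\<beta>\<close> on \<open>[0, \<infinity>)\<close>: the pointwise product of the two inverses, and the set on which
  it is defined.  Outside that set the values are arbitrary.\<close>

definition inv_prod :: "(real \<Rightarrow> real) \<Rightarrow> (real \<Rightarrow> real) \<Rightarrow> real \<Rightarrow> real" where
  "inv_prod \<alpha> \<beta> u = inv_into {0..} \<alpha> u * inv_into {0..} \<beta> u"

definition inv_prod_dom :: "(real \<Rightarrow> real) \<Rightarrow> (real \<Rightarrow> real) \<Rightarrow> real set" where
  "inv_prod_dom \<alpha> \<beta> = \<alpha> ` {0..} \<inter> \<beta> ` {0..}"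

lemma inj_on_inv_prod:
  assumes \<alpha>: "strict_antimono_on {0..} \<alpha>" and \<beta>: "strict_antimono_on {0..} \<beta>"
  shows "inj_on (inv_prod \<alpha> \<beta>) (inv_prod_dom \<alpha> \<beta>)"
proof -
  have inv: "0 \<le> inv_into {0..} \<gamma> v \<and> inv_into {0..} \<gamma> v < inv_into {0..} \<gamma> u"
    if \<gamma>: "strict_antimono_on {0..} \<gamma>" and "u \<in> \<gamma> ` {0..}" "v \<in> \<gamma> ` {0..}" "u < v"
    for \<gamma> :: "real \<Rightarrow> real" and u v
  proof -
    define a b where "a = inv_into {0..} \<gamma> u" and "b = inv_into {0..} \<gamma> v"
    have *: "0 \<le> a" "0 \<le> b" "\<gamma> a = u" "\<gamma> b = v"
      using that inv_into_into[of _ \<gamma> "{0..}"] f_inv_into_f[of _ \<gamma> "{0..}"]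
      unfolding a_def b_def by auto
    have "\<not> a \<le> b"
      using monotone_onD[OF \<gamma>, of a b] * \<open>u < v\<close> by (cases "a = b") auto
    then show ?thesis using * unfolding a_def b_def by auto
  qed
  have "inv_prod \<alpha> \<beta> v < inv_prod \<alpha> \<beta> u"
    if "u \<in> inv_prod_dom \<alpha> \<beta>" "v \<in> inv_prod_dom \<alpha> \<beta>" "u < v" for u v
    using inv[OF \<alpha>, of u v] inv[OF \<beta>, of u v] that
    unfolding inv_prod_def inv_prod_dom_def by (intro mult_strict_mono') auto
  then show ?thesis
    by (intro inj_onI) (metis linorder_neqE less_irrefl)
qed

lemma independent_copy_exists:
  fixes Z :: "'w \<Rightarrow> 'e::metric_space"
  assumes M: "prob_space M" and Z: "Z \<in> borel_measurable M"
  defines "N \<equiv> M \<Otimes>\<^sub>M distr M borel Z"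
  shows "prob_extension M N fst" and "independent_copy N (Z \<circ> fst) snd"
proof -
  define L where "L = distr M borel Z"
  interpret M: prob_space M by fact
  interpret L: prob_space L unfolding L_def using Z by (rule M.prob_space_distr)
  interpret P: pair_prob_space M L ..
  have N: "N = M \<Otimes>\<^sub>M L" unfolding N_def L_def ..
  have [simp]: "sets L = sets borel" unfolding L_def by simp
  have [measurable]: "Z \<in> borel_measurable M" by fact
  have d1: "distr N M fst = M"
    unfolding N by (rule L.distr_pair_fst)
  show "prob_extension M N fst"
    unfolding prob_extension_def using d1 P.prob_space_axioms by (simp add: N)
  have s: "snd \<in> measurable N borel"
    using measurable_snd[of M L] unfolding N by (simp cong: measurable_cong_sets)
  have d2: "distr N borel (Z \<circ> fst) = L"
  proof -
    have "distr (distr N M fst) borel Z = distr N borel (Z \<circ> fst)"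
      by (rule distr_distr) (auto simp: N)
    then show ?thesis using d1 L_def by simp
  qed
  have d3: "distr N borel snd = L"
  proof (rule measure_eqI)
    fix A assume "A \<in> sets (distr N borel snd)"
    then have A: "A \<in> sets borel" by simp
    have "emeasure (distr N borel snd) A = emeasure N (space M \<times> A)"
      using A s by (subst emeasure_distr)
        (auto simp: N space_pair_measure L_def intro!: arg_cong2[where f=emeasure])
    also have "\<dots> = emeasure L A"
      unfolding N using A by (subst L.emeasure_pair_measure_Times) (auto simp: M.emeasure_space_1)
    finally show "emeasure (distr N borel snd) A = emeasure L A" .
  qed (simp)
  have "distr N (borel \<Otimes>\<^sub>M borel) (\<lambda>x. ((Z \<circ> fst) x, snd x)) = L \<Otimes>\<^sub>M L"
  proof -
    have "distr M borel Z \<Otimes>\<^sub>M distr L borel (\<lambda>x. x) =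
        distr (M \<Otimes>\<^sub>M L) (borel \<Otimes>\<^sub>M borel) (\<lambda>(x, y). (Z x, y))"
      using L.sigma_finite_measure_axioms L.prob_space_distr[of "\<lambda>x. x" borel]
      by (intro pair_measure_distr)
        (auto simp: prob_space_imp_sigma_finite cong: measurable_cong_sets)
    moreover have "distr L borel (\<lambda>x. x) = L"
      by (rule distr_id2) simp
    ultimately show ?thesis unfolding N L_def[symmetric]
      by (simp add: case_prod_unfold)
  qed
  then have "prob_space.indep_var N borel (Z \<circ> fst) borel snd"
    using P.prob_space_axioms s unfolding N[symmetric]
    by (subst prob_space.indep_var_distribution_eq) (auto simp: d2 d3, auto simp: N)
  then show "independent_copy N (Z \<circ> fst) snd"
    unfolding independent_copy_def by (simp add: d2 d3)
qed

end

theory Submission imports Defs begin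

text \<open>Write \<open>t = a b\<close> with \<open>\<alpha> a = \<beta> b = u\<close>.  On the set \<open>A = {z. \<Lambda> z \<le> b}\<close> the function \<open>g \<circ> \<Phi>\<close>
  is \<open>b\<close>-Lipschitz, so it agrees on \<open>A\<close> with some \<open>b\<close>-Lipschitz function on the whole space.
  The event that \<open>g \<circ> \<Phi>\<close> varies by more than \<open>t\<close> is thus covered by the events
  \<open>\<Lambda> Z > b\<close>, \<open>\<Lambda> Z' > b\<close>, and the event that the extension divided by \<open>b\<close> varies by more than \<open>a\<close>;
  each has probability at most \<open>u\<close>.\<close>

text \<open>McShane extension: take the lower envelope of the cones
  \<open>f y + C * dist x y\<close> with apex \<open>y\<close> in \<open>A\<close>. Each cone is
  \<open>C\<close>-Lipschitz in \<open>x\<close>, and this passes to the infimum. The Lipschitz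
  bound on \<open>A\<close> keeps every cone above \<open>f\<close> on \<open>A\<close>, so the
  envelope gives back \<open>f\<close> there.\<close>

lemma lipschitz_on_extend_real:
  fixes f :: "'a::metric_space \<Rightarrow> real"
  assumes f: "C-lipschitz_on A f"
  obtains h where "C-lipschitz_on UNIV h" "\<And>x. x \<in> A \<Longrightarrow> h x = f x"
\<comment> \<open>The real infimum over an empty family carries no information, so this case gets a
  constant instead.\<close>
proof (cases "A = {}")
  case True
  have "C-lipschitz_on UNIV (\<lambda>_. 0 :: real)"
    using lipschitz_on_nonneg[OF f] by (auto intro!: lipschitz_onI)
  then show thesis using that True by blast
next
  case False
  have C: "0 \<le> C" using f by (rule lipschitz_on_nonneg)
  \<comment> \<open>Used twice: with any fixed \<open>z\<close> it bounds the cones at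
    \<open>x\<close> from below, and with \<open>z = x\<close> it yields
    \<open>f x \<le> h x\<close>.\<close>
  have lower: "f z - C * dist x z \<le> f y + C * dist x y" if "y \<in> A" "z \<in> A" for x y z
  proof -
    have "f z - f y \<le> C * dist z y"
      using lipschitz_onD[OF f \<open>z \<in> A\<close> \<open>y \<in> A\<close>] by (auto simp: dist_real_def)
    also have "\<dots> \<le> C * (dist x z + dist x y)"
      using C by (intro mult_left_mono) (auto simp: dist_triangle3)
    finally show ?thesis by (simp add: algebra_simps)
  qed
  define h where "h = (\<lambda>x. INF y\<in>A. f y + C * dist x y)"
  have bdd: "bdd_below ((\<lambda>y. f y + C * dist x y) ` A)" for x
  proof -
    from False obtain z where "z \<in> A" by blast
    then show ?thesis by (intro bdd_belowI2[where m = "f z - C * dist x z"] lower)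
  qed
  have diff: "h x - h x' \<le> C * dist x x'" for x x'
  proof -
    have "h x - C * dist x x' \<le> f y + C * dist x' y" if "y \<in> A" for y
    proof -
      have "h x \<le> f y + C * dist x y"
        unfolding h_def using bdd that by (rule cINF_lower)
      also have "C * dist x y \<le> C * (dist x x' + dist x' y)"
        using C by (intro mult_left_mono dist_triangle)
      finally show ?thesis by (simp add: algebra_simps)
    qed
    then have "h x - C * dist x x' \<le> h x'"
      unfolding h_def[THEN fun_cong, of x'] using False by (intro cINF_greatest)
    then show ?thesis by simp
  qed
  have "C-lipschitz_on UNIV h"
  proof (rule lipschitz_onI)
    show "dist (h x) (h x') \<le> C * dist x x'" for x x'
      using diff[of x x'] diff[of x' x] by (simp add: dist_real_def dist_commute abs_le_iff)
  qed (rule C)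
  moreover have "h x = f x" if "x \<in> A" for x
  proof (rule antisym)
    show "h x \<le> f x"
      using cINF_lower[OF bdd that, of x] by (simp add: h_def)
    show "f x \<le> h x"
      unfolding h_def using False lower[OF _ that, of _ x] by (intro cINF_greatest) auto
  qed
  ultimately show thesis by (rule that)
qed

lemma distr_independent_copy:
  assumes N: "prob_space N" and ind: "independent_copy N Y Y'"
  shows "distr N (borel \<Otimes>\<^sub>M borel) (\<lambda>\<omega>. (Y \<omega>, Y' \<omega>)) = distr N borel Y \<Otimes>\<^sub>M distr N borel Y"
  using ind unfolding independent_copy_def
  by (auto simp: prob_space.indep_var_distribution_eq[OF N])

lemma independent_copyD:
  assumes N: "prob_space N" and ind: "independent_copy N Y Y'"
  shows "Y \<in> borel_measurable N" "Y' \<in> borel_measurable N" "distr N borel Y' = distr N borel Y"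
  using ind unfolding independent_copy_def
  by (auto simp: prob_space.indep_var_distribution_eq[OF N])

lemma prob_eq_distr:
  assumes "X \<in> measurable N K" "Measurable.pred K P"
  shows "\<P>(\<omega> in N. P (X \<omega>)) = \<P>(x in distr N K X. P x)"
proof -
  have "{x \<in> space K. P x} \<in> sets K" using assms(2) by (rule predE)
  then have "measure (distr N K X) {x \<in> space K. P x} = measure N (X -` {x \<in> space K. P x} \<inter> space N)"
    using assms(1) by (intro measure_distr)
  also have "X -` {x \<in> space K. P x} \<inter> space N = {\<omega> \<in> space N. P (X \<omega>)}"
    using assms(1) by (auto dest: measurable_space)
  finally show ?thesis by simp
qed

text \<open>By independence the joint law is the product of the law of the first variable with
  itself, so that law alone decides the probability. The two spaces may have different types, which
  is what allows a bound to move from one extension to another.\<close>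

lemma prob_independent_copy_eq:
  assumes N: "prob_space N" "independent_copy N Y Y'"
    and N': "prob_space N'" "independent_copy N' X X'"
    and eq: "distr N borel Y = distr N' borel X"
    and P: "Measurable.pred (borel \<Otimes>\<^sub>M borel) P"
  shows "\<P>(\<omega> in N. P (Y \<omega>, Y' \<omega>)) = \<P>(\<omega> in N'. P (X \<omega>, X' \<omega>))"
proof -
  note [measurable] = independent_copyD(1,2)[OF N] independent_copyD(1,2)[OF N']
  show ?thesis
    using prob_eq_distr[of "\<lambda>\<omega>. (Y \<omega>, Y' \<omega>)" N "borel \<Otimes>\<^sub>M borel" P]
      prob_eq_distr[of "\<lambda>\<omega>. (X \<omega>, X' \<omega>)" N' "borel \<Otimes>\<^sub>M borel" P] P eq
    by (simp add: distr_independent_copy[OF N] distr_independent_copy[OF N'])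
qed

lemma prob_extension_distr:
  assumes "prob_extension M N \<pi>" "Z \<in> borel_measurable M"
  shows "distr N borel (Z \<circ> \<pi>) = distr M borel Z"
  using assms distr_distr[of Z M borel \<pi> N] unfolding prob_extension_def by simp

lemma lipschitz_on_borel_measurable:
  assumes "C-lipschitz_on UNIV f"
  shows "f \<in> borel_measurable borel"
  using assms by (intro borel_measurable_continuous_onI lipschitz_on_continuous_on)

lemma lipschitz_on_comp_sublevel:
  assumes g: "1-lipschitz_on UNIV (g :: 'f::metric_space \<Rightarrow> real)"
    and \<Phi>: "\<And>z z'. dist (\<Phi> z) (\<Phi> z') \<le> max (\<Lambda> z) (\<Lambda> z') * dist z z'"
    and b: "0 \<le> b"
  shows "b-lipschitz_on {z. \<Lambda> z \<le> b} (g \<circ> \<Phi>)"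
proof (rule lipschitz_onI)
  fix z z' assume "z \<in> {z. \<Lambda> z \<le> b}" "z' \<in> {z. \<Lambda> z \<le> b}"
  have "dist (g (\<Phi> z)) (g (\<Phi> z')) \<le> dist (\<Phi> z) (\<Phi> z')"
    using lipschitz_onD[OF g, of "\<Phi> z" "\<Phi> z'"] by simp
  also have "\<dots> \<le> max (\<Lambda> z) (\<Lambda> z') * dist z z'" by (rule \<Phi>)
  also have "\<dots> \<le> b * dist z z'"
    using \<open>z \<in> _\<close> \<open>z' \<in> _\<close> by (intro mult_right_mono) auto
  finally show "dist ((g \<circ> \<Phi>) z) ((g \<circ> \<Phi>) z') \<le> b * dist z z'" by simp
qed (rule b)

text \<open>Extends \<open>f / C\<close> rather than \<open>f\<close>, so that a hypothesis on
  1-Lipschitz maps applies directly. The conclusion multiplies by \<open>C\<close> instead of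
  dividing, so it survives \<open>C = 0\<close>: then \<open>f\<close> is constant on
  \<open>A\<close>, the quotient is 0 by convention, and both sides vanish. Hence the case
  \<open>b = 0\<close> needs no separate treatment later.\<close>

lemma lipschitz_on_scaled_extend_real:
  fixes f :: "'a::metric_space \<Rightarrow> real"
  assumes f: "C-lipschitz_on A f"
  obtains h where "1-lipschitz_on UNIV h"
    "\<And>x y. x \<in> A \<Longrightarrow> y \<in> A \<Longrightarrow> \<bar>f x - f y\<bar> = C * \<bar>h x - h y\<bar>"
proof -
  have C: "0 \<le> C" using f by (rule lipschitz_on_nonneg)
  have bound: "\<bar>f x - f y\<bar> \<le> C * dist x y" if "x \<in> A" "y \<in> A" for x y
    using lipschitz_onD[OF f that] by (simp add: dist_real_def)
  have "1-lipschitz_on A (\<lambda>x. f x / C)"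
  proof (rule lipschitz_onI)
    fix x y assume "x \<in> A" "y \<in> A"
    then show "dist (f x / C) (f y / C) \<le> 1 * dist x y"
      using bound[of x y] C
      by (cases "C = 0") (auto simp: dist_real_def field_simps simp flip: diff_divide_distrib)
  qed simp
  then obtain h where h: "1-lipschitz_on UNIV h" "\<And>x. x \<in> A \<Longrightarrow> h x = f x / C"
    by (rule lipschitz_on_extend_real) blast
  show thesis
  proof (rule that[OF h(1)])
    fix x y assume "x \<in> A" "y \<in> A"
    then show "\<bar>f x - f y\<bar> = C * \<bar>h x - h y\<bar>"
      using bound[of x y] h(2) C
      by (cases "C = 0") (auto simp flip: diff_divide_distrib)
  qed
qed

theorem theorem0p1:
  fixes M :: "'w measure"
    and Z :: "'w \<Rightarrow> 'e::metric_space"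
    and \<Lambda> :: "'e \<Rightarrow> real"
    and \<alpha> \<beta> :: "real \<Rightarrow> real"
    and \<Phi> :: "'e \<Rightarrow> 'f::metric_space"
  assumes "prob_space M"
    and "Z \<in> borel_measurable M"
    and "\<Lambda> \<in> borel_measurable borel"
    and "\<And>z. 0 \<le> \<Lambda> z"
    and "\<alpha> \<in> {0..} \<rightarrow> {0..}" and "strict_antimono_on {0..} \<alpha>"
    and "\<beta> \<in> {0..} \<rightarrow> {0..}" and "strict_antimono_on {0..} \<beta>"
    and "\<And>(f :: 'e \<Rightarrow> real) (N :: ('w \<times> 'e) measure) \<pi> Z' t.
           1-lipschitz_on UNIV f \<Longrightarrow> prob_extension M N \<pi> \<Longrightarrow>
           independent_copy N (Z \<circ> \<pi>) Z' \<Longrightarrow> 0 \<le> t \<Longrightarrow>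
           \<P>(\<omega> in N. \<bar>f (Z (\<pi> \<omega>)) - f (Z' \<omega>)\<bar> > t) \<le> \<alpha> t"
    and "\<And>t. 0 \<le> t \<Longrightarrow> \<P>(\<omega> in M. \<Lambda> (Z \<omega>) > t) \<le> \<beta> t"
    and "\<And>z z'. dist (\<Phi> z) (\<Phi> z') \<le> max (\<Lambda> z) (\<Lambda> z') * dist z z'"
  shows "\<forall>(g :: 'f \<Rightarrow> real) (N :: 'v measure) \<pi> Z'.
           1-lipschitz_on UNIV g \<longrightarrow> prob_extension M N \<pi> \<longrightarrow>
           independent_copy N (Z \<circ> \<pi>) Z' \<longrightarrow>
           (\<forall>t\<ge>0. t \<in> inv_prod \<alpha> \<beta> ` inv_prod_dom \<alpha> \<beta> \<longrightarrow>
              \<P>(\<omega> in N. \<bar>g (\<Phi> (Z (\<pi> \<omega>))) - g (\<Phi> (Z' \<omega>))\<bar> > t)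
                \<le> 3 * inv_into (inv_prod_dom \<alpha> \<beta>) (inv_prod \<alpha> \<beta>) t)"
proof (intro allI impI)
  fix g :: "'f \<Rightarrow> real" and N :: "'v measure" and \<pi> Z' t
  assume g: "1-lipschitz_on UNIV g" and ext: "prob_extension M N \<pi>"
    and copy: "independent_copy N (Z \<circ> \<pi>) Z'"
    and t: "t \<in> inv_prod \<alpha> \<beta> ` inv_prod_dom \<alpha> \<beta>"
  note Z = assms(2) and \<Lambda> [measurable] = assms(3)
  interpret N: prob_space N using ext by (simp add: prob_extension_def)
  note pN = N.prob_space_axioms
  have Z\<pi> [measurable]: "Z \<circ> \<pi> \<in> borel_measurable N" and Z' [measurable]: "Z' \<in> borel_measurable N"
    by (rule independent_copyD[OF pN copy])+
  obtain u where u: "u \<in> inv_prod_dom \<alpha> \<beta>" and tu: "t = inv_prod \<alpha> \<beta> u" using t by blast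
  define a b where "a = inv_into {0..} \<alpha> u" and "b = inv_into {0..} \<beta> u"
  have ab: "0 \<le> a" "0 \<le> b" "\<alpha> a = u" "\<beta> b = u"
    using u inv_into_into[of u \<alpha> "{0..}"] inv_into_into[of u \<beta> "{0..}"]
    by (auto simp: a_def b_def inv_prod_dom_def f_inv_into_f)
  have t_ab: "t = a * b" by (simp add: tu inv_prod_def a_def b_def)
  \<comment> \<open>Injectivity of the product of the inverses makes \<open>u\<close> the only
    preimage of \<open>t\<close>, so the bound to prove is \<open>3 * u\<close>.\<close>
  have inv: "inv_into (inv_prod_dom \<alpha> \<beta>) (inv_prod \<alpha> \<beta>) t = u"
    unfolding tu by (intro inv_into_f_f inj_on_inv_prod assms u)
  obtain h where h: "1-lipschitz_on UNIV h"
    and eq: "\<And>x y. \<Lambda> x \<le> b \<Longrightarrow> \<Lambda> y \<le> b \<Longrightarrow> \<bar>g (\<Phi> x) - g (\<Phi> y)\<bar> = b * \<bar>h x - h y\<bar>"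
    using lipschitz_on_scaled_extend_real[OF lipschitz_on_comp_sublevel[OF g assms(11) ab(2)]]
    by (auto simp: comp_def)
  have hm [measurable]: "h \<in> borel_measurable borel" using h by (rule lipschitz_on_borel_measurable)
  define A where "A = {\<omega> \<in> space N. \<Lambda> ((Z \<circ> \<pi>) \<omega>) > b}"
  define A' where "A' = {\<omega> \<in> space N. \<Lambda> (Z' \<omega>) > b}"
  define B where "B = {\<omega> \<in> space N. \<bar>h ((Z \<circ> \<pi>) \<omega>) - h (Z' \<omega>)\<bar> > a}"
  have sets: "A \<in> sets N" "A' \<in> sets N" "B \<in> sets N"
    unfolding A_def A'_def B_def by measurable
  have dZ: "distr N borel (Z \<circ> \<pi>) = distr M borel Z" using ext Z by (rule prob_extension_distr)
  have pred\<Lambda>: "Measurable.pred borel (\<lambda>z. b < \<Lambda> z)" by measurable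
  \<comment> \<open>Stated for the law of \<open>Z\<close>, which \<open>Z \<circ> \<pi>\<close> and
    \<open>Z'\<close> share, so that one estimate serves both \<open>A\<close> and
    \<open>A'\<close>.\<close>
  have tail: "\<P>(z in distr M borel Z. b < \<Lambda> z) \<le> u"
    using assms(10)[OF ab(2)] ab(4) prob_eq_distr[OF Z pred\<Lambda>] by simp
  have A: "measure N A \<le> u"
    using tail unfolding A_def prob_eq_distr[OF Z\<pi> pred\<Lambda>] dZ .
  have A': "measure N A' \<le> u"
    using tail unfolding A'_def prob_eq_distr[OF Z' pred\<Lambda>] independent_copyD(3)[OF pN copy] dZ .
  have B: "measure N B \<le> u"
  proof -
    \<comment> \<open>The concentration hypothesis only speaks about extensions on the type \<open>'w \<times> 'e\<close>; it reaches \<open>N\<close>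
      because the joint law of \<open>Z\<close> and an independent copy does not depend on the extension.\<close>
    define N' where "N' = M \<Otimes>\<^sub>M distr M borel Z"
    have ext': "prob_extension M N' fst" and copy': "independent_copy N' (Z \<circ> fst) snd"
      unfolding N'_def using assms(1) Z by (rule independent_copy_exists)+
    have pN': "prob_space N'" using ext' by (simp add: prob_extension_def)
    \<comment> \<open>The event is phrased as a Borel predicate of the pair, the form in which it
      can be compared between \<open>N\<close> and \<open>N'\<close>.\<close>
    have "\<P>(\<omega> in N. a < (\<lambda>(x, y). \<bar>h x - h y\<bar>) ((Z \<circ> \<pi>) \<omega>, Z' \<omega>)) =
        \<P>(\<omega> in N'. a < (\<lambda>(x, y). \<bar>h x - h y\<bar>) ((Z \<circ> fst) \<omega>, snd \<omega>))"
      by (rule prob_independent_copy_eq[OF pN copy pN' copy'])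
        (simp_all add: dZ prob_extension_distr[OF ext' Z], measurable)
    also have "\<dots> \<le> u"
      using assms(9)[OF h ext' copy' ab(1)] ab(3) by simp
    finally show ?thesis by (simp add: B_def)
  qed
  have sub: "{\<omega> \<in> space N. \<bar>g (\<Phi> (Z (\<pi> \<omega>))) - g (\<Phi> (Z' \<omega>))\<bar> > t} \<subseteq> A \<union> A' \<union> B"
  proof
    fix \<omega> assume \<omega>: "\<omega> \<in> {\<omega> \<in> space N. \<bar>g (\<Phi> (Z (\<pi> \<omega>))) - g (\<Phi> (Z' \<omega>))\<bar> > t}"
    show "\<omega> \<in> A \<union> A' \<union> B"
    proof (rule ccontr)
      assume "\<omega> \<notin> A \<union> A' \<union> B"
      then have *: "\<Lambda> (Z (\<pi> \<omega>)) \<le> b" "\<Lambda> (Z' \<omega>) \<le> b" "\<bar>h (Z (\<pi> \<omega>)) - h (Z' \<omega>)\<bar> \<le> a"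
        using \<omega> by (auto simp: A_def A'_def B_def not_less)
      have "\<bar>g (\<Phi> (Z (\<pi> \<omega>))) - g (\<Phi> (Z' \<omega>))\<bar> \<le> b * a"
        unfolding eq[OF *(1,2)] using *(3) ab(2) by (rule mult_left_mono)
      then show False using \<omega> by (simp add: t_ab mult.commute)
    qed
  qed
  \<comment> \<open>\<open>\<Phi>\<close> need not be measurable, but monotonicity only needs the larger set to be.\<close>
  have "\<P>(\<omega> in N. \<bar>g (\<Phi> (Z (\<pi> \<omega>))) - g (\<Phi> (Z' \<omega>))\<bar> > t) \<le> measure N (A \<union> A' \<union> B)"
    using sub sets by (intro N.finite_measure_mono) auto
  also have "\<dots> \<le> measure N A + measure N A' + measure N B"
    using sets measure_Un_le[of "A \<union> A'" N B] measure_Un_le[of A N A'] by auto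
  also have "\<dots> \<le> 3 * u" using A A' B by simp
  finally show "\<P>(\<omega> in N. \<bar>g (\<Phi> (Z (\<pi> \<omega>))) - g (\<Phi> (Z' \<omega>))\<bar> > t)
      \<le> 3 * inv_into (inv_prod_dom \<alpha> \<beta>) (inv_prod \<alpha> \<beta>) t" unfolding inv .
qed

end
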